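(* Let $A,B:\mathbb N\to\mathbb C^{s\times s}$ be supported on $\{0,\ldots,N_A-1\}$ and $\{0,\ldots,N_B-1\}$ respectively, let $L\ge N_A+N_B-1$ be a power of two, and let $C=A*B$ be computed by zero-padding to length $L$, componentwise FFTs, frequency-domain matrix multiplication, and an inverse FFT, under the floating-point model with constants $\sigma_L,\gamma_s\ge0$ described in the context. If $C_{\mathrm{fl}}$ is the floating-point result, then $$\|C-C_{\mathrm{fl}}\|_{G,L}\le\sqrt L\,\|A\|_{G,L}\|B\|_{G,L}\,\delta_{L,s}.$$ If $C\ne0$, the corresponding relative bound is $$\frac{\|C-C_{\mathrm{fl}}\|_{G,L}}{\|C\|_{G,L}}\le\kappa_{\mathrm{conv}}(A,B)\,\delta_{L,s},\qquad \kappa_{\mathrm{conv}}(A,B):=\frac{\sqrt L\,\|A\|_{G,L}\|B\|_{G,L}}{\|A*B\|_{G,L}}.$$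
   Context: Convolution: $(A*B)(k)=\sum_{\ell=0}^kA(\ell)B(k-\ell)$. Write $I_L=\{0,\ldots,L-1\}$. For an array $X=(X(m))_{m\in I_L}$ of $s\times s$ complex matrices, $\|X\|_{G,L}=(\sum_{m\in I_L}\|X(m)\|_F^2)^{1/2}$, with $\|\cdot\|_F$ the Frobenius norm. Sequences supported on $I_L$ are identified with arrays. The DFT is $\widehat A(m)=\sum_{k=0}^{L-1}A(k)\exp(-2\pi\mathrm i km/L)$, $m\in I_L$, applied entrywise, and $\operatorname{IDFT}_L$ is its inverse; exactly, $A*B=\operatorname{IDFT}_L(\widehat A(m)\widehat B(m))_{m\in I_L}$. Floating-point model. The computed forward transforms $\widehat A_{\mathrm{fl}},\widehat B_{\mathrm{fl}}$ satisfy the relative Euclidean bounds $\|\widehat A_{\mathrm{fl}}-\widehat A\|_{G,L}\le\sigma_L\|\widehat A\|_{G,L}$ and $\|\widehat B_{\mathrm{fl}}-\widehat B\|_{G,L}\le\sigma_L\|\widehat B\|_{G,L}$. The computed frequency-domain products $Z_{\mathrm{fl}}(m)=\mathrm{fl}(\widehat A_{\mathrm{fl}}(m)\widehat B_{\mathrm{fl}}(m))$ satisfy $\|\mathrm{fl}(XY)-XY\|_F\le\gamma_s\|X\|_F\|Y\|_F$ for each product of $s\times s$ matrices $X,Y$ formed. The computed inverse transform $C_{\mathrm{fl}}$ of $Z_{\mathrm{fl}}$ satisfies $\|C_{\mathrm{fl}}-\operatorname{IDFT}_L(Z_{\mathrm{fl}})\|_{G,L}\le\sigma_L\|\operatorname{IDFT}_L(Z_{\mathrm{fl}})\|_{G,L}$.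 (With $u$ the unit roundoff, $\sigma_L=\mathcal O(u\log L)$ for a radix-two Cooley–Tukey implementation and $\gamma_s=\mathcal O(su)$; these magnitudes are not needed for the bound.) Constants: $\beta_{L,s}:=2\sigma_L+\sigma_L^2+\gamma_s(1+\sigma_L)^2$ and $\delta_{L,s}:=\beta_{L,s}+\sigma_L(1+\beta_{L,s})$. *)

theory Defs
  imports "HOL-Analysis.Analysis"
begin

text \<open>
  Matrices of size s are elements of \<^typ>\<open>complex ^ 's ^ 's\<close> with s the cardinality of the
  index type.  An array indexed by {0, ..., L - 1} is represented by any function on the
  natural numbers; everything below only looks at its values at indices smaller than L, so that
  a sequence supported there is its own zero-padded array.
\<close>

text \<open>The library norm on matrices is the Frobenius norm.\<close>

lemma norm_eq_frobenius:
  fixes X :: "complex ^ 's::finite ^ 's"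
  shows "norm X = sqrt (\<Sum>i\<in>UNIV. \<Sum>j\<in>UNIV. (cmod (X $ i $ j))\<^sup>2)"
  by (simp add: norm_vec_def L2_set_def sum_nonneg)

definition normG :: "nat \<Rightarrow> (nat \<Rightarrow> complex ^ 's::finite ^ 's) \<Rightarrow> real" where
  "normG L X = sqrt (\<Sum>m<L. (norm (X m))\<^sup>2)"

definition conv ::
    "(nat \<Rightarrow> complex ^ 's::finite ^ 's) \<Rightarrow> (nat \<Rightarrow> complex ^ 's ^ 's) \<Rightarrow> nat \<Rightarrow> complex ^ 's ^ 's"
  where "conv A B k = (\<Sum>l=0..k. A l ** B (k - l))"

definition dft :: "nat \<Rightarrow> (nat \<Rightarrow> complex ^ 's::finite ^ 's) \<Rightarrow> nat \<Rightarrow> complex ^ 's ^ 's" where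
  "dft L A m =
     (\<chi> i j. \<Sum>k<L. A k $ i $ j * exp (- (2 * of_real pi * \<i> * of_nat k * of_nat m / of_nat L)))"

text \<open>
  The inverse of the transform on arrays of length L; the result is normalised to vanish outside
  the index range.  The lemma \<open>idft_eq\<close> gives the usual formula, and with it existence and
  uniqueness.
\<close>

definition idft :: "nat \<Rightarrow> (nat \<Rightarrow> complex ^ 's::finite ^ 's) \<Rightarrow> nat \<Rightarrow> complex ^ 's ^ 's" where
  "idft L Y = (THE X. (\<forall>k\<ge>L. X k = 0) \<and> (\<forall>m<L. dft L X m = Y m))"

lemma sum_roots_of_unity_orthogonal:
  fixes L p q :: nat
  assumes "p < L" "q < L"
  shows "(\<Sum>k<L. exp (2 * of_real pi * \<i> * of_nat k * of_nat p / of_nat L)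
                * exp (- (2 * of_real pi * \<i> * of_nat k * of_nat q / of_nat L)))
         = (if p = q then of_nat L else (0::complex))"
proof -
  define w :: complex where
    "w = exp (2 * of_real pi * \<i> * of_nat p / of_nat L) / exp (2 * of_real pi * \<i> * of_nat q / of_nat L)"
  have L: "L \<noteq> 0" using assms by simp
  have pow: "exp (2 * of_real pi * \<i> * of_nat k * of_nat r / of_nat L)
      = exp (2 * of_real pi * \<i> * of_nat r / of_nat L :: complex) ^ k" for k r
    by (simp add: exp_of_nat_mult [symmetric] mult_ac)
  have term_eq: "exp (2 * of_real pi * \<i> * of_nat k * of_nat p / of_nat L)
      * exp (- (2 * of_real pi * \<i> * of_nat k * of_nat q / of_nat L)) = w ^ k" for k
    unfolding exp_minus pow w_def by (simp add: power_divide field_simps)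
  have wL: "w ^ L = 1"
    unfolding w_def power_divide by (simp add: complex_root_unity L)
  have w1: "w = 1 \<longleftrightarrow> p = q"
    using complex_root_unity_eq [of L p q] assms L by (simp add: w_def cong_def)
  show ?thesis
    unfolding term_eq using w1 wL by (cases "p = q") (simp_all add: geometric_sum)
qed

lemma idft_eq:
  fixes Y :: "nat \<Rightarrow> complex ^ 's::finite ^ 's"
  assumes "k < L"
  shows "idft L Y k =
    (\<chi> i j. (\<Sum>m<L. Y m $ i $ j * exp (2 * of_real pi * \<i> * of_nat m * of_nat k / of_nat L)) / of_nat L)"
proof -
  define e :: "nat \<Rightarrow> nat \<Rightarrow> complex"
    where "e = (\<lambda>k m. exp (2 * of_real pi * \<i> * of_nat k * of_nat m / of_nat L))"
  define e' :: "nat \<Rightarrow> nat \<Rightarrow> complex"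
    where "e' = (\<lambda>k m. exp (- (2 * of_real pi * \<i> * of_nat k * of_nat m / of_nat L)))"
  define X :: "nat \<Rightarrow> complex ^ 's ^ 's" where
    "X = (\<lambda>k. if k < L then (\<chi> i j. (\<Sum>m<L. Y m $ i $ j * e m k) / of_nat L) else 0)"
  have L: "L \<noteq> 0" using assms by simp
  have orth: "(\<Sum>k<L. e k p * e' k q) = (if p = q then of_nat L else 0)"
    if "p < L" "q < L" for p q
    using sum_roots_of_unity_orthogonal [OF that] by (simp add: e_def e'_def)
  have sym: "e p q = e q p" "e' p q = e' q p" for p q
    by (simp_all add: e_def e'_def mult_ac)
  have dft: "dft L Z m $ i $ j = (\<Sum>k<L. Z k $ i $ j * e' k m)"
    for Z :: "nat \<Rightarrow> complex ^ 's ^ 's" and m i j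
    by (simp add: dft_def e'_def)
  have right_inv: "dft L X m = Y m" if m: "m < L" for m
  proof -
    have "dft L X m $ i $ j = Y m $ i $ j" for i j
    proof -
      have "dft L X m $ i $ j = (\<Sum>k<L. (\<Sum>n<L. Y n $ i $ j * e n k) / of_nat L * e' k m)"
        unfolding dft by (rule sum.cong) (simp_all add: X_def)
      also have "\<dots> = (\<Sum>k<L. \<Sum>n<L. Y n $ i $ j * (e k n * e' k m) / of_nat L)"
        by (simp add: sum_distrib_left sum_divide_distrib sym(1) mult_ac)
      also have "\<dots> = (\<Sum>n<L. \<Sum>k<L. Y n $ i $ j * (e k n * e' k m) / of_nat L)"
        by (rule sum.swap)
      also have "\<dots> = (\<Sum>n<L. Y n $ i $ j * (\<Sum>k<L. e k n * e' k m) / of_nat L)"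
        by (simp add: sum_distrib_left sum_divide_distrib)
      also have "\<dots> = (\<Sum>n<L. if n = m then Y n $ i $ j else 0)"
        by (rule sum.cong) (use L m in \<open>simp_all add: orth\<close>)
      finally show ?thesis using m by simp
    qed
    then show ?thesis by (simp add: vec_eq_iff)
  qed
  have uniq: "Z = X" if Z: "\<forall>k\<ge>L. Z k = 0" "\<forall>m<L. dft L Z m = Y m" for Z
  proof
    fix k
    show "Z k = X k"
    proof (cases "k < L")
      case k: True
      have "X k $ i $ j = Z k $ i $ j" for i j
      proof -
        have "X k $ i $ j = (\<Sum>m<L. dft L Z m $ i $ j * e m k) / of_nat L"
          using Z(2) k by (simp add: X_def)
        also have "\<dots> = (\<Sum>m<L. \<Sum>n<L. Z n $ i $ j * (e m k * e' m n) / of_nat L)"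
          unfolding dft by (simp add: sum_distrib_left sum_divide_distrib sym(2) mult_ac)
        also have "\<dots> = (\<Sum>n<L. \<Sum>m<L. Z n $ i $ j * (e m k * e' m n) / of_nat L)"
          by (rule sum.swap)
        also have "\<dots> = (\<Sum>n<L. Z n $ i $ j * (\<Sum>m<L. e m k * e' m n) / of_nat L)"
          by (simp add: sum_distrib_left sum_divide_distrib)
        also have "\<dots> = (\<Sum>n<L. if n = k then Z n $ i $ j else 0)"
          by (rule sum.cong) (use L k in \<open>auto simp: orth\<close>)
        finally show ?thesis using k by simp
      qed
      then show ?thesis by (simp add: vec_eq_iff)
    qed (use Z(1) in \<open>simp add: X_def\<close>)
  qed
  have "idft L Y = X"
    unfolding idft_def
    by (rule the_equality) (use right_inv uniq in \<open>auto simp: X_def\<close>)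
  then show ?thesis using assms by (simp add: X_def e_def)
qed

definition conv_beta :: "real \<Rightarrow> real \<Rightarrow> real" where
  "conv_beta \<sigma> \<gamma> = 2 * \<sigma> + \<sigma>\<^sup>2 + \<gamma> * (1 + \<sigma>)\<^sup>2"

definition conv_delta :: "real \<Rightarrow> real \<Rightarrow> real" where
  "conv_delta \<sigma> \<gamma> = conv_beta \<sigma> \<gamma> + \<sigma> * (1 + conv_beta \<sigma> \<gamma>)"

definition kappa_conv ::
    "nat \<Rightarrow> (nat \<Rightarrow> complex ^ 's::finite ^ 's) \<Rightarrow> (nat \<Rightarrow> complex ^ 's ^ 's) \<Rightarrow> real" where
  "kappa_conv L A B = sqrt (real L) * normG L A * normG L B / normG L (conv A B)"

text \<open>
  The floating-point model: \<open>Ahat\<close>, \<open>Bhat\<close>, \<open>Z\<close>, \<open>C\<close> are the computed forward transforms, the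
  computed frequency-domain products and the computed inverse transform.  Only the rounding error
  bounds of the operations actually performed are required.
\<close>

definition fl_convolution ::
    "nat \<Rightarrow> real \<Rightarrow> real \<Rightarrow> (nat \<Rightarrow> complex ^ 's::finite ^ 's) \<Rightarrow> (nat \<Rightarrow> complex ^ 's ^ 's) \<Rightarrow>
     (nat \<Rightarrow> complex ^ 's ^ 's) \<Rightarrow> (nat \<Rightarrow> complex ^ 's ^ 's) \<Rightarrow>
     (nat \<Rightarrow> complex ^ 's ^ 's) \<Rightarrow> (nat \<Rightarrow> complex ^ 's ^ 's) \<Rightarrow> bool" where
  "fl_convolution L \<sigma> \<gamma> A B Ahat Bhat Z C \<longleftrightarrow>
     normG L (\<lambda>m. Ahat m - dft L A m) \<le> \<sigma> * normG L (dft L A) \<and>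
     normG L (\<lambda>m. Bhat m - dft L B m) \<le> \<sigma> * normG L (dft L B) \<and>
     (\<forall>m<L. norm (Z m - Ahat m ** Bhat m) \<le> \<gamma> * norm (Ahat m) * norm (Bhat m)) \<and>
     normG L (\<lambda>m. C m - idft L Z m) \<le> \<sigma> * normG L (idft L Z)"

end

theory Submission
  imports Defs
begin

text \<open>
  Up to the factor \<open>sqrt L\<close> the DFT is an isometry for \<^const>\<open>normG\<close> (Parseval), and it turns
  convolution into pointwise matrix products.  The Frobenius norm is submultiplicative, and so is
  \<^const>\<open>normG\<close> for pointwise products since the \<open>\<ell>\<^sup>2\<close> norm is bounded by the \<open>\<ell>\<^sup>1\<close> norm.  Hence the error of
  the computed frequency-domain products is at most \<open>conv_beta\<close> times the product of the norms
  of the transforms.  The exact inverse transform divides it by \<open>sqrt L\<close>, and rounding in the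
  inverse transform contributes the remaining term of \<open>conv_delta\<close>.
\<close>

section \<open>Submultiplicativity of the Frobenius norm\<close>

lemma norm_matrix_power2:
  fixes X :: "complex ^ 's::finite ^ 's"
  shows "(norm X)\<^sup>2 = (\<Sum>i\<in>UNIV. \<Sum>j\<in>UNIV. (cmod (X $ i $ j))\<^sup>2)"
  unfolding norm_eq_frobenius by (simp add: sum_nonneg)

text \<open>Cauchy-Schwarz bounds each entry of the product by a row of \<open>X\<close> against a
  column of \<open>Y\<close>; the sum of the squared bounds over all entries factorizes.\<close>

lemma norm_matrix_mult_le:
  fixes X Y :: "complex ^ 's::finite ^ 's"
  shows "norm (X ** Y) \<le> norm X * norm Y"
proof (rule power2_le_imp_le)
  have entry: "(cmod ((X ** Y) $ i $ j))\<^sup>2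
      \<le> (\<Sum>h\<in>UNIV. (cmod (X $ i $ h))\<^sup>2) * (\<Sum>h\<in>UNIV. (cmod (Y $ h $ j))\<^sup>2)" for i j
  proof -
    have "cmod ((X ** Y) $ i $ j) \<le> (\<Sum>h\<in>UNIV. cmod (X $ i $ h) * cmod (Y $ h $ j))"
      unfolding matrix_matrix_mult_def by (simp add: sum_norm_le norm_mult)
    also have "\<dots> \<le> L2_set (\<lambda>h. cmod (X $ i $ h)) UNIV * L2_set (\<lambda>h. cmod (Y $ h $ j)) UNIV"
      using L2_set_mult_ineq[of "\<lambda>h. cmod (X $ i $ h)" "\<lambda>h. cmod (Y $ h $ j)" UNIV] by simp
    finally have "(cmod ((X ** Y) $ i $ j))\<^sup>2 \<le> \<dots>\<^sup>2"
      by (rule power_mono) simp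
    then show ?thesis
      by (simp add: power_mult_distrib L2_set_def sum_nonneg)
  qed
  have "(norm (X ** Y))\<^sup>2 \<le> (\<Sum>i\<in>UNIV. \<Sum>j\<in>UNIV.
      (\<Sum>h\<in>UNIV. (cmod (X $ i $ h))\<^sup>2) * (\<Sum>h\<in>UNIV. (cmod (Y $ h $ j))\<^sup>2))"
    unfolding norm_matrix_power2 by (intro sum_mono entry)
  also have "\<dots> = (\<Sum>i\<in>UNIV. \<Sum>h\<in>UNIV. (cmod (X $ i $ h))\<^sup>2)
      * (\<Sum>j\<in>UNIV. \<Sum>h\<in>UNIV. (cmod (Y $ h $ j))\<^sup>2)"
    by (simp add: sum_product)
  also have "(\<Sum>j\<in>UNIV. \<Sum>h\<in>UNIV. (cmod (Y $ h $ j))\<^sup>2) = (norm Y)\<^sup>2"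
    unfolding norm_matrix_power2 by (rule sum.swap)
  also have "(\<Sum>i\<in>UNIV. \<Sum>h\<in>UNIV. (cmod (X $ i $ h))\<^sup>2) = (norm X)\<^sup>2"
    unfolding norm_matrix_power2 ..
  finally show "(norm (X ** Y))\<^sup>2 \<le> (norm X * norm Y)\<^sup>2"
    by (simp add: power_mult_distrib)
qed simp

section \<open>The array norm and pointwise products\<close>

lemma normG_L2_set: "normG L X = L2_set (\<lambda>m. norm (X m)) {..<L}"
  unfolding normG_def L2_set_def ..

lemma normG_nonneg [simp]: "0 \<le> normG L X"
  unfolding normG_L2_set by simp

lemma normG_power2: "(normG L X)\<^sup>2 = (\<Sum>m<L. (norm (X m))\<^sup>2)"
  unfolding normG_def by (simp add: sum_nonneg)

lemma normG_cong: "(\<And>m. m < L \<Longrightarrow> X m = Y m) \<Longrightarrow> normG L X = normG L Y"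
  unfolding normG_def by (auto intro!: sum.cong)

lemma normG_minus_commute: "normG L (\<lambda>m. X m - Y m) = normG L (\<lambda>m. Y m - X m)"
  unfolding normG_def by (simp add: norm_minus_commute)

lemma normG_triangle: "normG L (\<lambda>m. X m + Y m) \<le> normG L X + normG L Y"
proof -
  have "normG L (\<lambda>m. X m + Y m) \<le> L2_set (\<lambda>m. norm (X m) + norm (Y m)) {..<L}"
    unfolding normG_L2_set by (rule L2_set_mono) (simp_all add: norm_triangle_ineq)
  also have "\<dots> \<le> normG L X + normG L Y"
    unfolding normG_L2_set by (rule L2_set_triangle_ineq)
  finally show ?thesis .
qed

lemma normG_perturbed_le:
  assumes "normG L (\<lambda>m. X m - Y m) \<le> e"
  shows "normG L X \<le> normG L Y + e"
  using normG_triangle[of L "\<lambda>m. X m - Y m" Y] assms by simp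

text \<open>Each \<open>norm (Y m)\<close> is at most \<open>normG L Y\<close>, which can then be
  pulled out of the sum of squares. The constant \<open>c\<close> is 1 for exact products and
  \<open>\<gamma>\<close> for their rounding errors.\<close>

lemma normG_le_product:
  assumes "c \<ge> 0" and le: "\<And>m. m < L \<Longrightarrow> norm (Z m) \<le> c * norm (X m) * norm (Y m)"
  shows "normG L Z \<le> c * normG L X * normG L Y"
proof (rule power2_le_imp_le)
  have "(normG L Z)\<^sup>2 \<le> (\<Sum>m<L. c\<^sup>2 * (norm (X m))\<^sup>2 * (norm (Y m))\<^sup>2)"
    unfolding normG_power2
    using le by (intro sum_mono) (force simp: power_mult_distrib[symmetric] intro: power_mono)
  also have "\<dots> \<le> (\<Sum>m<L. c\<^sup>2 * (norm (X m))\<^sup>2 * (normG L Y)\<^sup>2)"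
    unfolding normG_power2
    by (intro sum_mono mult_left_mono member_le_sum) simp_all
  also have "\<dots> = (c * normG L X * normG L Y)\<^sup>2"
    by (simp add: power_mult_distrib normG_power2[of L X] sum_distrib_left sum_distrib_right)
  finally show "(normG L Z)\<^sup>2 \<le> (c * normG L X * normG L Y)\<^sup>2" .
qed (use assms in simp)

lemma normG_matrix_mult_le: "normG L (\<lambda>m. X m ** Y m) \<le> normG L X * normG L Y"
  using normG_le_product[of 1 L "\<lambda>m. X m ** Y m" X Y] norm_matrix_mult_le by auto

section \<open>Parseval's identity for both transforms\<close>

lemma parseval_roots_of_unity:
  fixes f :: "nat \<Rightarrow> complex"
  shows "(\<Sum>k<L. (cmod (\<Sum>m<L. f m * exp (2 * of_real pi * \<i> * of_nat m * of_nat k / of_nat L)))\<^sup>2)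
    = L * (\<Sum>m<L. (cmod (f m))\<^sup>2)"
proof -
  define e where "e p k = (exp (2 * of_real pi * \<i> * of_nat k * of_nat p / of_nat L) :: complex)"
    for p k :: nat
  have orth: "(\<Sum>k<L. e p k * cnj (e q k)) = (if p = q then of_nat L else 0)"
    if "p < L" "q < L" for p q
    using sum_roots_of_unity_orthogonal[OF that] by (simp add: e_def exp_cnj)
  \<comment> \<open>In the complex numbers the squared modulus is \<open>z * cnj z\<close>, so the
    square expands into a double sum; orthogonality of the roots of unity keeps only its diagonal,
    with weight \<open>L\<close>.\<close>
  have "(of_real (\<Sum>k<L. (cmod (\<Sum>m<L. f m * e m k))\<^sup>2) :: complex)
      = (\<Sum>k<L. (\<Sum>p<L. f p * e p k) * cnj (\<Sum>q<L. f q * e q k))"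
    by (simp only: of_real_sum complex_norm_square)
  also have "\<dots> = (\<Sum>k<L. \<Sum>p<L. \<Sum>q<L. f p * cnj (f q) * (e p k * cnj (e q k)))"
    by (simp add: sum_product mult_ac)
  also have "\<dots> = (\<Sum>p<L. \<Sum>k<L. \<Sum>q<L. f p * cnj (f q) * (e p k * cnj (e q k)))"
    by (rule sum.swap)
  also have "\<dots> = (\<Sum>p<L. \<Sum>q<L. f p * cnj (f q) * (\<Sum>k<L. e p k * cnj (e q k)))"
    unfolding sum_distrib_left by (intro sum.cong refl sum.swap)
  also have "\<dots> = (\<Sum>p<L. \<Sum>q<L. if p = q then of_nat L * (f p * cnj (f q)) else 0)"
    by (intro sum.cong refl) (simp add: orth)
  also have "\<dots> = of_real (L * (\<Sum>m<L. (cmod (f m))\<^sup>2))"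
    by (simp add: sum_distrib_left complex_norm_square del: of_real_power)
  finally have "(\<Sum>k<L. (cmod (\<Sum>m<L. f m * e m k))\<^sup>2) = L * (\<Sum>m<L. (cmod (f m))\<^sup>2)"
    by (simp only: of_real_eq_iff)
  then show ?thesis
    by (simp add: e_def mult_ac)
qed

text \<open>Squared Frobenius norms are sums over entries, so scalar Parseval lifts to matrices:
  \<open>c\<close> is \<open>L\<close> for the forward transform and \<open>1 / L\<close> for the
  inverse.\<close>

lemma normG_entrywise_isometry:
  fixes X Y :: "nat \<Rightarrow> complex ^ 's::finite ^ 's"
  assumes "\<And>i j. (\<Sum>m<L. (cmod (Y m $ i $ j))\<^sup>2) = c * (\<Sum>m<L. (cmod (X m $ i $ j))\<^sup>2)"
  shows "normG L Y = sqrt c * normG L X"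
proof -
  have entries: "(\<Sum>m<L. (norm (W m))\<^sup>2) = (\<Sum>i\<in>UNIV. \<Sum>j\<in>UNIV. \<Sum>m<L. (cmod (W m $ i $ j))\<^sup>2)"
    for W :: "nat \<Rightarrow> complex ^ 's ^ 's"
    unfolding norm_matrix_power2
    by (subst sum.swap) (intro sum.cong refl sum.swap)
  show ?thesis
    unfolding normG_def entries assms
    by (simp flip: sum_distrib_left add: real_sqrt_mult)
qed

lemma normG_dft: "normG L (dft L X) = sqrt L * normG L X"
proof (rule normG_entrywise_isometry)
  fix i j
  \<comment> \<open>The forward kernel is the conjugate of the one in
    \<open>parseval_roots_of_unity\<close>; conjugating the whole sum moves the conjugation to the
    entries and preserves the modulus.\<close>
  have "cmod (dft L X k $ i $ j) = cmod (\<Sum>m<L. cnj (X m $ i $ j)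
      * exp (2 * of_real pi * \<i> * of_nat m * of_nat k / of_nat L))" for k
  proof -
    have "dft L X k $ i $ j = cnj (\<Sum>m<L. cnj (X m $ i $ j)
        * exp (2 * of_real pi * \<i> * of_nat m * of_nat k / of_nat L))"
      by (simp add: dft_def exp_cnj)
    then show ?thesis by (simp only: complex_mod_cnj)
  qed
  then show "(\<Sum>k<L. (cmod (dft L X k $ i $ j))\<^sup>2) = L * (\<Sum>m<L. (cmod (X m $ i $ j))\<^sup>2)"
    by (simp add: parseval_roots_of_unity)
qed

lemma normG_idft: "normG L (idft L Y) = normG L Y / sqrt L"
proof -
  have "normG L (idft L Y) = sqrt (1 / L) * normG L Y"
  proof (rule normG_entrywise_isometry)
    fix i j
    have "(\<Sum>k<L. (cmod (idft L Y k $ i $ j))\<^sup>2) = (\<Sum>k<L. (cmod (\<Sum>m<L. Y m $ i $ j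
        * exp (2 * of_real pi * \<i> * of_nat m * of_nat k / of_nat L)))\<^sup>2) / (real L)\<^sup>2"
      unfolding sum_divide_distrib
      by (intro sum.cong refl) (simp add: idft_eq norm_divide power_divide)
    \<comment> \<open>The squared normalisation \<open>1 / L\<close> meets the factor
      \<open>L\<close> from Parseval.\<close>
    then show "(\<Sum>k<L. (cmod (idft L Y k $ i $ j))\<^sup>2) = 1 / L * (\<Sum>m<L. (cmod (Y m $ i $ j))\<^sup>2)"
      unfolding parseval_roots_of_unity by (simp add: power2_eq_square)
  qed
  then show ?thesis by (simp add: real_sqrt_divide)
qed

section \<open>Inversion and the convolution theorem\<close>

lemma idft_diff:
  assumes "k < L"
  shows "idft L X k - idft L Y k = idft L (\<lambda>m. X m - Y m) k"
  using assms by (simp add: idft_eq vec_eq_iff left_diff_distrib sum_subtractf diff_divide_distrib)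

lemma dft_diff: "dft L (\<lambda>m. X m - Y m) k = dft L X k - dft L Y k"
  by (simp add: dft_def vec_eq_iff left_diff_distrib sum_subtractf)

text \<open>Uniqueness comes from Parseval: the difference of two candidates has zero transform,
  hence zero norm on the index range, and outside it both vanish.\<close>

lemma idft_dft:
  assumes supp: "\<And>k. k \<ge> L \<Longrightarrow> X k = 0" and Y: "\<And>m. m < L \<Longrightarrow> Y m = dft L X m"
  shows "idft L Y = X"
  unfolding idft_def
proof (rule the_equality)
  fix Z assume Z: "(\<forall>k\<ge>L. Z k = 0) \<and> (\<forall>m<L. dft L Z m = Y m)"
  have "sqrt L * normG L (\<lambda>m. Z m - X m) = normG L (\<lambda>_. 0 :: complex ^ 'a ^ 'a)"
    unfolding normG_dft[symmetric] by (rule normG_cong) (use Y Z in \<open>simp add: dft_diff\<close>)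
  then have "L = 0 \<or> (\<Sum>m<L. (norm (Z m - X m))\<^sup>2) = 0"
    by (simp add: normG_def)
  then have "Z k = X k" if "k < L" for k
    using that by (auto simp: sum_nonneg_eq_0_iff)
  then show "Z = X"
    using Z supp by (metis ext not_less)
qed (use assms in simp)

text \<open>This is multiplication of polynomials evaluated at \<open>w\<close>, with the product
  grouped by degree.\<close>

lemma sum_convolution_power:
  fixes f g :: "nat \<Rightarrow> 'a::comm_semiring_1"
  assumes "\<And>p q. L \<le> p + q \<Longrightarrow> f p * g q = 0"
  shows "(\<Sum>k<L. (\<Sum>l\<le>k. f l * g (k - l)) * w ^ k) = (\<Sum>p<L. f p * w ^ p) * (\<Sum>q<L. g q * w ^ q)"
proof -
  have "(\<Sum>k<L. (\<Sum>l\<le>k. f l * g (k - l)) * w ^ k)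
      = (\<Sum>k<L. \<Sum>l\<le>k. f l * g (k - l) * w ^ (l + (k - l)))"
    by (simp add: sum_distrib_right)
  also have "\<dots> = (\<Sum>(p, q)\<in>{(p, q). p + q < L}. f p * g q * w ^ (p + q))"
    by (rule sum.triangle_reindex[symmetric])
  \<comment> \<open>The pairs that complete the triangle to a square satisfy
    \<open>L \<le> p + q\<close>, so their terms vanish.\<close>
  also have "\<dots> = (\<Sum>(p, q)\<in>{..<L} \<times> {..<L}. f p * g q * w ^ (p + q))"
    by (rule sum.mono_neutral_left) (auto, metis assms mult_zero_left not_less)
  also have "\<dots> = (\<Sum>p<L. f p * w ^ p) * (\<Sum>q<L. g q * w ^ q)"
    by (simp add: sum_product sum.cartesian_product power_add mult_ac)
  finally show ?thesis .
qed

text \<open>The support condition excludes wraparound, so the linear convolution agrees with the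
  cyclic one. Each entry of the transform is a polynomial evaluated at a root of unity
  \<open>w\<close>, which reduces the claim to \<open>sum_convolution_power\<close> for each inner
  index \<open>h\<close>.\<close>

lemma dft_conv:
  fixes A B :: "nat \<Rightarrow> complex ^ 's::finite ^ 's"
  assumes supp: "\<And>p q. L \<le> p + q \<Longrightarrow> A p = 0 \<or> B q = 0"
  shows "dft L (conv A B) m = dft L A m ** dft L B m"
proof -
  define w :: complex where "w = exp (- (2 * of_real pi * \<i> * of_nat m / of_nat L))"
  have w: "exp (- (2 * of_real pi * \<i> * of_nat k * of_nat m / of_nat L)) = w ^ k" for k
    by (simp add: w_def exp_of_nat_mult[symmetric] mult_ac)
  have "dft L (conv A B) m $ i $ j = (dft L A m ** dft L B m) $ i $ j" for i j
  proof -
    have "dft L (conv A B) m $ i $ j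
        = (\<Sum>k<L. (\<Sum>l\<le>k. \<Sum>h\<in>UNIV. A l $ i $ h * B (k - l) $ h $ j) * w ^ k)"
      by (simp add: dft_def w conv_def matrix_matrix_mult_def atLeast0AtMost)
    also have "\<dots> = (\<Sum>k<L. \<Sum>h\<in>UNIV. (\<Sum>l\<le>k. A l $ i $ h * B (k - l) $ h $ j) * w ^ k)"
      by (subst sum.swap) (simp add: sum_distrib_right)
    also have "\<dots> = (\<Sum>h\<in>UNIV. \<Sum>k<L. (\<Sum>l\<le>k. A l $ i $ h * B (k - l) $ h $ j) * w ^ k)"
      by (rule sum.swap)
    also have "\<dots> = (\<Sum>h\<in>UNIV. (\<Sum>p<L. A p $ i $ h * w ^ p) * (\<Sum>q<L. B q $ h $ j * w ^ q))"
      by (intro sum.cong refl sum_convolution_power) (use supp in fastforce)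
    also have "\<dots> = (dft L A m ** dft L B m) $ i $ j"
      by (simp add: dft_def w matrix_matrix_mult_def)
    finally show ?thesis .
  qed
  then show ?thesis by (simp add: vec_eq_iff)
qed

lemma conv_eq_0:
  fixes A B :: "nat \<Rightarrow> complex ^ 's::finite ^ 's"
  assumes "\<And>p q. L \<le> p + q \<Longrightarrow> A p = 0 \<or> B q = 0" "L \<le> k"
  shows "conv A B k = 0"
  unfolding conv_def
proof (rule sum.neutral, rule ballI)
  fix l assume "l \<in> {0..k}"
  then have "A l = 0 \<or> B (k - l) = 0"
    using assms(1)[of l "k - l"] assms(2) by simp
  then show "A l ** B (k - l) = 0"
    by (auto simp: matrix_matrix_mult_def vec_eq_iff)
qed

section \<open>Propagation of rounding errors\<close>

lemma normG_fl_products_error: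
  fixes X Y X' Y' Z :: "nat \<Rightarrow> complex ^ 's::finite ^ 's"
  assumes X': "normG L (\<lambda>m. X' m - X m) \<le> \<sigma> * normG L X"
    and Y': "normG L (\<lambda>m. Y' m - Y m) \<le> \<sigma> * normG L Y"
    and Z: "\<And>m. m < L \<Longrightarrow> norm (Z m - X' m ** Y' m) \<le> \<gamma> * norm (X' m) * norm (Y' m)"
    and "\<sigma> \<ge> 0" "\<gamma> \<ge> 0"
  shows "normG L (\<lambda>m. Z m - X m ** Y m) \<le> conv_beta \<sigma> \<gamma> * (normG L X * normG L Y)"
proof -
  let ?x = "normG L X" and ?y = "normG L Y"
  have nX: "normG L X' \<le> (1 + \<sigma>) * ?x" and nY: "normG L Y' \<le> (1 + \<sigma>) * ?y"
    using normG_perturbed_le[OF X'] normG_perturbed_le[OF Y'] by (simp_all add: algebra_simps)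
  \<comment> \<open>The three terms are the rounding of the product and the perturbations of the
    left and right factors. Their coefficients \<open>\<gamma> * (1 + \<sigma>)\<^sup>2\<close>,
    \<open>\<sigma> * (1 + \<sigma>)\<close> and \<open>\<sigma>\<close> add up to
    \<open>conv_beta\<close>.\<close>
  have split: "Z m - X m ** Y m
      = (Z m - X' m ** Y' m) + ((X' m - X m) ** Y' m + X m ** (Y' m - Y m))" for m
    by (simp add: matrix_matrix_mult_def vec_eq_iff left_diff_distrib right_diff_distrib
        sum_subtractf)
  have "normG L (\<lambda>m. Z m - X m ** Y m) \<le> normG L (\<lambda>m. Z m - X' m ** Y' m)
      + (normG L (\<lambda>m. (X' m - X m) ** Y' m) + normG L (\<lambda>m. X m ** (Y' m - Y m)))"
    unfolding split by (intro order_trans[OF normG_triangle] add_left_mono normG_triangle)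
  also have "\<dots> \<le> \<gamma> * ((1 + \<sigma>) * ?x) * ((1 + \<sigma>) * ?y)
      + (\<sigma> * ?x * ((1 + \<sigma>) * ?y) + ?x * (\<sigma> * ?y))"
  proof (intro add_mono)
    show "normG L (\<lambda>m. Z m - X' m ** Y' m) \<le> \<gamma> * ((1 + \<sigma>) * ?x) * ((1 + \<sigma>) * ?y)"
      by (rule order_trans[OF normG_le_product[OF \<open>\<gamma> \<ge> 0\<close> Z]])
        (use nX nY assms(4,5) in \<open>auto intro!: mult_mono\<close>)
    show "normG L (\<lambda>m. (X' m - X m) ** Y' m) \<le> \<sigma> * ?x * ((1 + \<sigma>) * ?y)"
      by (rule order_trans[OF normG_matrix_mult_le])
        (use X' nY assms(4) in \<open>auto intro!: mult_mono\<close>)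
    show "normG L (\<lambda>m. X m ** (Y' m - Y m)) \<le> ?x * (\<sigma> * ?y)"
      by (rule order_trans[OF normG_matrix_mult_le]) (use Y' in \<open>auto intro!: mult_mono\<close>)
  qed
  also have "\<dots> = conv_beta \<sigma> \<gamma> * (?x * ?y)"
    by (simp add: conv_beta_def algebra_simps power2_eq_square)
  finally show ?thesis .
qed

text \<open>The exact inverse transform of the computed products serves as intermediate point: its
  distance to \<open>conv A B\<close> gives \<open>conv_beta\<close>, and its distance to
  \<open>C\<close> gives the rest of \<open>conv_delta\<close>.\<close>

lemma fl_convolution_error:
  fixes A B Ahat Bhat Z C :: "nat \<Rightarrow> complex ^ 's::finite ^ 's"
  assumes supp: "\<And>p q. L \<le> p + q \<Longrightarrow> A p = 0 \<or> B q = 0"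
    and "\<sigma> \<ge> 0" "\<gamma> \<ge> 0"
    and fl: "fl_convolution L \<sigma> \<gamma> A B Ahat Bhat Z C"
  shows "normG L (\<lambda>m. conv A B m - C m)
    \<le> sqrt (real L) * normG L A * normG L B * conv_delta \<sigma> \<gamma>"
proof -
  let ?P = "\<lambda>m. dft L A m ** dft L B m" and ?K = "sqrt (real L) * normG L A * normG L B"
  let ?b = "conv_beta \<sigma> \<gamma>"
  have K: "normG L (dft L A) * normG L (dft L B) / sqrt L = ?K"
    unfolding normG_dft by simp
  have conv: "conv A B = idft L ?P"
    by (rule idft_dft[symmetric]) (simp_all add: conv_eq_0[OF supp] dft_conv[OF supp])
  have "normG L (\<lambda>m. idft L Z m - conv A B m) = normG L (\<lambda>m. Z m - ?P m) / sqrt L"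
    unfolding conv normG_idft[symmetric] by (rule normG_cong) (rule idft_diff)
  also have "\<dots> \<le> ?b * (normG L (dft L A) * normG L (dft L B)) / sqrt L"
    using fl assms(2,3) unfolding fl_convolution_def
    by (intro divide_right_mono normG_fl_products_error) auto
  also have "\<dots> = ?b * ?K"
    unfolding K[symmetric] by simp
  finally have err: "normG L (\<lambda>m. idft L Z m - conv A B m) \<le> ?b * ?K" .
  have "normG L (conv A B) \<le> ?K"
    unfolding conv normG_idft K[symmetric] by (intro divide_right_mono normG_matrix_mult_le) simp
  \<comment> \<open>The last rounding error is relative to the perturbed array
    \<open>idft L Z\<close>, not to \<open>conv A B\<close>; hence the factor
    \<open>1 + ?b\<close>.\<close>
  then have nZ: "normG L (idft L Z) \<le> (1 + ?b) * ?K"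
    using normG_perturbed_le[OF err] by (simp add: algebra_simps)
  have "normG L (\<lambda>m. conv A B m - C m)
      \<le> normG L (\<lambda>m. C m - idft L Z m) + normG L (\<lambda>m. idft L Z m - conv A B m)"
    using normG_triangle[of L "\<lambda>m. C m - idft L Z m" "\<lambda>m. idft L Z m - conv A B m"]
    by (simp add: normG_minus_commute[of L "conv A B"])
  also have "\<dots> \<le> \<sigma> * ((1 + ?b) * ?K) + ?b * ?K"
    using fl err mult_left_mono[OF nZ \<open>\<sigma> \<ge> 0\<close>] unfolding fl_convolution_def by linarith
  also have "\<dots> = ?K * conv_delta \<sigma> \<gamma>"
    unfolding conv_delta_def by algebra
  finally show ?thesis .
qed

theorem proposition2p1:
  fixes A B Ahat_fl Bhat_fl Z_fl C_fl :: "nat \<Rightarrow> complex ^ 's::finite ^ 's"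
    and N\<^sub>A N\<^sub>B L :: nat and \<sigma> \<gamma> :: real
  assumes "\<And>k. k \<ge> N\<^sub>A \<Longrightarrow> A k = 0"
    and "\<And>k. k \<ge> N\<^sub>B \<Longrightarrow> B k = 0"
    and "L \<ge> N\<^sub>A + N\<^sub>B - 1"
    and "\<exists>p::nat. L = 2 ^ p"
    and "\<sigma> \<ge> 0" and "\<gamma> \<ge> 0"
    and "fl_convolution L \<sigma> \<gamma> A B Ahat_fl Bhat_fl Z_fl C_fl"
  shows "normG L (\<lambda>m. conv A B m - C_fl m)
           \<le> sqrt (real L) * normG L A * normG L B * conv_delta \<sigma> \<gamma>
         \<and> (conv A B \<noteq> (\<lambda>_. 0) \<longrightarrow>
             normG L (\<lambda>m. conv A B m - C_fl m) / normG L (conv A B)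
               \<le> kappa_conv L A B * conv_delta \<sigma> \<gamma>)"
proof -
  have supp: "A p = 0 \<or> B q = 0" if "L \<le> p + q" for p q
  proof -
    \<comment> \<open>Otherwise \<open>p + q \<le> N\<^sub>A + N\<^sub>B - 2\<close>, which lies
      below \<open>L\<close>. The subtraction truncates only for
      \<open>N\<^sub>A = N\<^sub>B = 0\<close>, where both disjuncts hold.\<close>
    have "N\<^sub>A \<le> p \<or> N\<^sub>B \<le> q"
      using that assms(3) by linarith
    then show ?thesis using assms(1,2) by blast
  qed
  have bound: "normG L (\<lambda>m. conv A B m - C_fl m)
      \<le> sqrt (real L) * normG L A * normG L B * conv_delta \<sigma> \<gamma>"
    using supp assms(5-7) by (rule fl_convolution_error)
  then show ?thesis
    using divide_right_mono[OF bound, of "normG L (conv A B)"] by (simp add: kappa_conv_def)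
qed

end
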